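(* Let $n\ge 3$ and let $K,L$ be $R_\theta$-invariant $h$-convex bodies in $\mathbb{R}^{2n}\cong\mathbb{C}^n$ such that $$\mathrm{HVol}_{2}(K\cap H)\le \mathrm{HVol}_{2}(L\cap H)$$ for every complex linear subspace $H\subset\mathbb{C}^n$ of complex dimension $1$. Then $$\mathrm{HVol}_{2n}(K)\le\mathrm{HVol}_{2n}(L).$$
   Context: Identify $\mathbb{C}^n$ with $\mathbb{R}^{2n}$ via $(\xi_{11}+i\xi_{12},\dots,\xi_{n1}+i\xi_{n2})\mapsto(\xi_{11},\xi_{12},\dots,\xi_{n1},\xi_{n2})$. The complex hyperbolic space $\mathbb{H}^n_{\mathbb{C}}$ is modelled on the open unit ball $B^n=\{z\in\mathbb{C}^n: |z|<1\}$ with the Bergman metric. Bodies are compact sets containing the origin as an interior point. For a body $K$ that is star-shaped about the origin, $\|x\|_K=\min\{a\ge 0: x\in aK\}$ is its Minkowski functional, so $\|x\|_K^{-1}$, $x\in S^{2n-1}$, is the Euclidean distance from the origin to the boundary of $K$ in the direction $x$. A body $K\subset\mathbb{R}^{2n}$ is $R_\theta$-invariant if for every $\theta\in[0,2\pi]$ and every $\xi\in\mathbb{R}^{2n}$ one has $\|\xi\|_K=\|(R_\theta(\xi_{11},\xi_{12}),\dots,R_\theta(\xi_{n1},\xi_{n2}))\|_K$, where $R_\theta$ is the counterclockwise rotation of $\mathbb{R}^2$ by the angle $\theta$; equivalently, $K$ is invariant under $z\mapsto e^{i\theta}z$ on $\mathbb{C}^n$. Geodesic segments: for distinct $x,y\in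 B^n$ let $\ell$ be the unique affine complex line through $x$ and $y$. Then $\ell\cap B^n$ is a round open disc, say of radius $R$, on which the Bergman metric restricts to the Poincaré metric $\frac{4R^2\,dz\,d\bar z}{(R^2-r^2)^2}$, where $r$ is the Euclidean distance to the center of the disc. The geodesic segment joining $x$ and $y$ is the Poincaré geodesic segment joining them in this disc (an arc of a circle in $\ell$ orthogonal to the boundary circle of the disc, or a segment of a diameter of the disc). A body contained in $B^n$ is $h$-convex if it contains, with any two of its points, the geodesic segment joining them. Such a body is star-shaped about the origin. Hyperbolic volume: for a complex linear subspace $H\subset\mathbb{C}^n$ of complex dimension $m$, $1\le m\le n$, and an $h$-convex body $K$, $$\mathrm{HVol}_{2m}(K\cap H)=8^{m}\int_{S^{2n-1}\cap H}\int_0^{\|x\|_K^{-1}}\frac{r^{2m-1}}{(1-r^2)^{m+1}}\,dr\,d\sigma(x),$$ where $\sigma$ is the surface measure on the unit sphere $S^{2n-1}\cap H$ of $H$. In particular, for $H=\mathbb{C}^n$ this is $\mathrm{HVol}_{2n}(K)$. *)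

theory Defs
  imports "HOL-Analysis.Analysis"
begin

text \<open>
  Real \<open>2n\<close>-space, identified with complex \<open>n\<close>-space, is the type \<open>complex ^ 'n\<close> with \<open>n = CARD('n)\<close>;
  its library norm is the Euclidean norm of real \<open>2n\<close>-space. Complex subspaces and complex dimension
  are \<open>vec.subspace\<close> and \<open>vec.dim\<close>, whereas \<open>span\<close>, \<open>dim\<close> and \<open>*\<^sub>R\<close> refer to the real structure.
\<close>

section \<open>Bodies\<close>

definition body :: "'a::euclidean_space set \<Rightarrow> bool" where
  "body K \<longleftrightarrow> compact K \<and> 0 \<in> interior K"

definition minkowski_functional :: "'a::real_vector set \<Rightarrow> 'a \<Rightarrow> real" where
  "minkowski_functional K x = (LEAST a. 0 \<le> a \<and> x \<in> (\<lambda>y. a *\<^sub>R y) ` K)"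

text \<open>Counterclockwise rotation of a complex coordinate by \<open>\<theta>\<close> is multiplication by \<open>cis \<theta>\<close>.\<close>

definition R_theta_invariant :: "(complex ^ 'n) set \<Rightarrow> bool" where
  "R_theta_invariant K \<longleftrightarrow>
     (\<forall>\<theta>\<in>{0..2 * pi}. \<forall>\<xi>. minkowski_functional K \<xi> = minkowski_functional K (\<chi> i. cis \<theta> * \<xi> $ i))"

section \<open>Geodesic segments and h-convexity\<close>

definition complex_line :: "complex ^ 'n \<Rightarrow> complex ^ 'n \<Rightarrow> (complex ^ 'n) set" where
  "complex_line x y = range (\<lambda>t. x + t *s (y - x))"

text \<open>
  The length of \<open>\<gamma>\<close> in the Poincare metric of the disc with centre \<open>c\<close> and radius \<open>R\<close>. It is a
  nonnegative integral because paths that are piecewise C1 in the library sense can have infinite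
  length (the derivative may be unbounded near an exceptional point).
\<close>

definition poincare_length :: "'a::euclidean_space \<Rightarrow> real \<Rightarrow> (real \<Rightarrow> 'a) \<Rightarrow> ennreal" where
  "poincare_length c R \<gamma> =
     (\<integral>\<^sup>+ t\<in>{0..1}. ennreal (2 * R * norm (vector_derivative \<gamma> (at t)) / (R\<^sup>2 - (dist c (\<gamma> t))\<^sup>2)) \<partial>lborel)"

definition paths_in :: "'a::euclidean_space set \<Rightarrow> 'a \<Rightarrow> 'a \<Rightarrow> (real \<Rightarrow> 'a) set" where
  "paths_in D x y = {\<gamma>. \<gamma> piecewise_C1_differentiable_on {0..1} \<and> path_image \<gamma> \<subseteq> D \<and>
     pathstart \<gamma> = x \<and> pathfinish \<gamma> = y}"

text \<open>
  The points on the curves of least Poincare length from \<open>x\<close> to \<open>y\<close> in the disc cut out of the unit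
  ball by the complex line through \<open>x\<close> and \<open>y\<close>. The centre \<open>c\<close> and the radius \<open>R\<close> of this disc are
  uniquely determined, and all minimising curves have the same image, namely the circular arc
  orthogonal to the boundary (or the piece of a diameter) that joins \<open>x\<close> and \<open>y\<close>.
\<close>

definition geodesic_segment :: "complex ^ 'n \<Rightarrow> complex ^ 'n \<Rightarrow> (complex ^ 'n) set" where
  "geodesic_segment x y =
     {z. \<exists>D c R \<gamma>. D = complex_line x y \<inter> ball 0 1 \<and>
        c \<in> complex_line x y \<and> 0 < R \<and> D = complex_line x y \<inter> ball c R \<and>
        \<gamma> \<in> paths_in D x y \<and>
        (\<forall>\<delta>\<in>paths_in D x y. poincare_length c R \<gamma> \<le> poincare_length c R \<delta>) \<and>
        z \<in> path_image \<gamma>}"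

definition h_convex :: "(complex ^ 'n) set \<Rightarrow> bool" where
  "h_convex K \<longleftrightarrow> K \<subseteq> ball 0 1 \<and> (\<forall>x\<in>K. \<forall>y\<in>K. x \<noteq> y \<longrightarrow> geodesic_segment x y \<subseteq> K)"

section \<open>Hyperbolic volume\<close>

text \<open>
  Lebesgue measure on a real subspace \<open>H\<close>, as a Borel measure on the ambient space: the construction
  of \<open>lborel\<close> with an orthonormal basis of \<open>H\<close> in place of \<open>Basis\<close>. The result does not depend on the
  basis, by rotation invariance of Lebesgue measure.
\<close>

definition orthonormal_basis_of :: "'a::euclidean_space set \<Rightarrow> 'a set \<Rightarrow> bool" where
  "orthonormal_basis_of H B \<longleftrightarrow> pairwise orthogonal B \<and> (\<forall>b\<in>B. norm b = 1) \<and> span B = H"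

definition lborel_subspace :: "'a::euclidean_space set \<Rightarrow> 'a measure" where
  "lborel_subspace H =
     (let B = (SOME B. orthonormal_basis_of H B)
      in distr (\<Pi>\<^sub>M b\<in>B. lborel) borel (\<lambda>f. \<Sum>b\<in>B. f b *\<^sub>R b))"

text \<open>
  Surface measure on the unit sphere of a subspace \<open>H\<close> of real dimension \<open>d\<close>, normalised as usual:
  the measure of \<open>A\<close> is \<open>d\<close> times the Lebesgue measure on \<open>H\<close> of the cone \<open>{t *\<^sub>R x | 0 < t < 1, x \<in> A}\<close>,
  so that Lebesgue measure on \<open>H\<close> is \<open>r ^ (d - 1) dr d\<sigma>\<close> in polar coordinates. Here \<open>sgn x\<close> is
  \<open>x /\<^sub>R norm x\<close>.
\<close>

definition surface_measure :: "'a::euclidean_space set \<Rightarrow> 'a measure" where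
  "surface_measure H =
     distr (scale_measure (of_nat (dim H)) (restrict_space (lborel_subspace H) (ball 0 1 - {0}))) borel sgn"

text \<open>
  \<open>HVol H K\<close> is the volume of real dimension \<open>2m\<close> of \<open>K \<inter> H\<close>, where \<open>m\<close> is the complex dimension
  of \<open>H\<close>.
\<close>

definition HVol :: "(complex ^ 'n) set \<Rightarrow> (complex ^ 'n) set \<Rightarrow> ennreal" where
  "HVol H K =
     (let m = vec.dim H
      in 8 ^ m * (\<integral>\<^sup>+ x \<in> sphere 0 1 \<inter> H.
           (\<integral>\<^sup>+ r \<in> {0..inverse (minkowski_functional K x)}.
              ennreal (r ^ (2 * m - 1) / (1 - r\<^sup>2) ^ (m + 1)) \<partial>lborel) \<partial>surface_measure H))"

end

theory Submission
  imports Defs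
begin

text \<open>
  An invariant body meets a complex line \<open>H\<close> through the origin in a round disc about the origin.
  The area of this disc is a strictly increasing function of its radius, so comparing areas compares
  radii. Every real direction lies in some \<open>H\<close>; hence the radial function of \<open>K\<close> is pointwise at most
  that of \<open>L\<close>, and the volume integrals are compared pointwise.
\<close>

section \<open>The Minkowski functional of a body\<close>

text \<open>The \<open>LEAST\<close> ranges over reals, so a minimum has to be exhibited. The set
  \<open>T\<close> of all \<open>t\<close> with \<open>t *\<^sub>R x\<close> in \<open>K\<close> is
  compact because \<open>x\<close> is nonzero, and its maximum \<open>s\<close> is positive because
  \<open>K\<close> contains a ball about 0. The minimal scaling factor is then
  \<open>inverse s\<close>.\<close>

lemma minkowski_functional_attained:
  fixes K :: "'a::euclidean_space set"
  assumes "body K" and "x \<noteq> 0"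
  shows "0 < minkowski_functional K x \<and> inverse (minkowski_functional K x) *\<^sub>R x \<in> K"
proof -
  have K: "compact K" "0 \<in> interior K"
    using assms(1) by (auto simp: body_def)
  define T where "T = {t. t *\<^sub>R x \<in> K}"
  have T_eq: "T = (\<lambda>t. t *\<^sub>R x) -` K"
    by (auto simp: T_def)
  have "closed T"
    unfolding T_eq using K(1)
    by (intro continuous_closed_vimage compact_imp_closed) (auto intro!: continuous_intros)
  moreover obtain C where C: "\<And>y. y \<in> K \<Longrightarrow> norm y \<le> C"
    using K(1) compact_imp_bounded bounded_iff by metis
  have "\<bar>t\<bar> \<le> C / norm x" if "t \<in> T" for t
    using C[of "t *\<^sub>R x"] that assms(2) by (simp add: T_def field_simps)
  then have "bounded T"
    unfolding bounded_iff by auto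
  ultimately have "compact T"
    by (simp add: compact_eq_bounded_closed)
  moreover have "T \<noteq> {}"
    using subsetD[OF interior_subset K(2)] by (auto simp: T_def intro!: exI[of _ 0])
  ultimately obtain s where s: "s \<in> T" "\<And>t. t \<in> T \<Longrightarrow> t \<le> s"
    using compact_attains_sup by metis
  obtain e where e: "0 < e" "ball 0 e \<subseteq> K"
    using K(2) mem_interior by blast
  \<comment> \<open>This multiple of \<open>x\<close> has norm \<open>e / 2\<close>, so it lies in
    the ball of radius \<open>e\<close>.\<close>
  have "(e / (2 * norm x)) *\<^sub>R x \<in> K"
    using e assms(2) by (intro subsetD[OF e(2)]) simp
  then have "e / (2 * norm x) \<le> s"
    by (intro s(2)) (simp add: T_def)
  moreover have "0 < e / (2 * norm x)"
    using e(1) assms(2) by simp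
  ultimately have "0 < s"
    by linarith
  have "minkowski_functional K x = inverse s"
    unfolding minkowski_functional_def
  proof (rule Least_equality)
    have "x = inverse s *\<^sub>R (s *\<^sub>R x)"
      using \<open>0 < s\<close> by simp
    then show "0 \<le> inverse s \<and> x \<in> (\<lambda>y. inverse s *\<^sub>R y) ` K"
      using s(1) \<open>0 < s\<close> by (auto simp: T_def intro: image_eqI[of _ _ "s *\<^sub>R x"])
  next
    fix a assume a: "0 \<le> a \<and> x \<in> (\<lambda>y. a *\<^sub>R y) ` K"
    then obtain y where y: "y \<in> K" "x = a *\<^sub>R y"
      by auto
    have "0 < a"
      using a y assms(2) by (cases "a = 0") auto
    then have "inverse a \<in> T"
      using y by (simp add: T_def)
    then have "inverse a \<le> s"
      by (rule s(2))
    then show "inverse s \<le> a"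
      using \<open>0 < a\<close> \<open>0 < s\<close> by (simp add: field_simps)
  qed
  then show ?thesis
    using s(1) \<open>0 < s\<close> by (simp add: T_def)
qed

text \<open>The multiple of \<open>x\<close> on the boundary belongs to \<open>K\<close> and has
  norm \<open>inverse (minkowski_functional K x)\<close>, which is below 1 since the ball is open.
  This keeps the radial integrals away from the singularity at \<open>r = 1\<close>.\<close>

lemma minkowski_functional_gt_1:
  fixes K :: "'a::euclidean_space set"
  assumes "body K" and "K \<subseteq> ball 0 1" and "norm x = 1"
  shows "1 < minkowski_functional K x"
proof -
  have "x \<noteq> 0"
    using assms(3) by auto
  note \<mu> = minkowski_functional_attained[OF assms(1) this]
  have "norm (inverse (minkowski_functional K x) *\<^sub>R x) < 1"
    using \<mu> assms(2) by auto
  then show ?thesis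
    using \<mu> assms(3) by (simp add: field_simps)
qed

section \<open>Complex lines through the origin\<close>

lemma vec_subspace_imp_subspace:
  fixes H :: "(complex ^ 'n) set"
  assumes "vec.subspace H"
  shows "subspace H"
proof -
  have "c *\<^sub>R x = complex_of_real c *s x" for c and x :: "complex ^ 'n"
    unfolding vec_eq_iff by (simp add: scaleR_conv_of_real[where ?'a = complex])
  then show ?thesis
    using assms by (auto simp: subspace_def vec.subspace_def)
qed

lemma norm_vector_scalar_mult:
  fixes x :: "complex ^ 'n"
  shows "norm (c *s x) = norm c * norm x"
  by (simp add: norm_vec_def norm_mult L2_set_right_distrib)

text \<open>Two unit vectors on one complex line differ by a factor of modulus 1, which is a
  rotation \<open>cis \<theta>\<close>.\<close>

lemma minkowski_functional_constant_on_span: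
  fixes K :: "(complex ^ 'n) set"
  assumes "R_theta_invariant K" and "norm x = 1" and "norm y = 1" and "y \<in> vec.span {x}"
  shows "minkowski_functional K y = minkowski_functional K x"
proof -
  obtain c where c: "y = c *s x"
    using assms(4) by (auto simp: vec.span_singleton)
  then have "norm c = 1"
    using assms(2,3) by (simp add: norm_vector_scalar_mult)
  then obtain \<theta> where \<theta>: "0 \<le> \<theta>" "\<theta> < 2 * pi" "c = cis \<theta>"
    using Arg2pi[of c] by (auto simp: cis_conv_exp is_Arg_def)
  have "y = (\<chi> i. cis \<theta> * x $ i)"
    by (simp add: c \<theta>(3) vec_eq_iff)
  then show ?thesis
    using assms(1) \<theta> unfolding R_theta_invariant_def by (metis atLeastAtMost_iff less_imp_le)
qed

section \<open>Surface measure of a whole sphere\<close>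

lemma orthonormal_basis_of_exists:
  fixes H :: "'a::euclidean_space set"
  assumes "subspace H"
  shows "\<exists>B. orthonormal_basis_of H B"
  using orthonormal_basis_subspace[OF assms] unfolding orthonormal_basis_of_def by metis

lemma orthonormal_basis_of_finite:
  fixes H :: "'a::euclidean_space set"
  assumes "orthonormal_basis_of H B"
  shows "finite B"
  using assms pairwise_orthogonal_imp_finite unfolding orthonormal_basis_of_def by blast

lemma orthonormal_basis_of_inner_sum:
  fixes H :: "'a::euclidean_space set"
  assumes "orthonormal_basis_of H B" and "b \<in> B"
  shows "(\<Sum>a\<in>B. f a *\<^sub>R a) \<bullet> b = f b"
proof -
  have "a \<bullet> b = (if a = b then 1 else 0)" if "a \<in> B" for a
    using assms that unfolding orthonormal_basis_of_def pairwise_def orthogonal_def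
    by (auto simp: dot_square_norm)
  then have "(\<Sum>a\<in>B. f a *\<^sub>R a) \<bullet> b = (\<Sum>a\<in>B. if a = b then f a else 0)"
    unfolding inner_sum_left by (intro sum.cong) auto
  then show ?thesis
    using assms(2) orthonormal_basis_of_finite[OF assms(1)] by simp
qed

text \<open>This mass is a common factor of the areas of both sections; positivity and finiteness
  are what allows cancelling it. Up to the factor \<open>dim H\<close> it is the volume of the
  punctured unit ball of \<open>H\<close>, which is enclosed between two boxes in orthonormal
  coordinates.\<close>

lemma emeasure_surface_measure_sphere:
  fixes H :: "'a::euclidean_space set"
  assumes "subspace H" and "H \<noteq> {0}"
  shows "0 < emeasure (surface_measure H) (sphere 0 1 \<inter> H)"
    and "emeasure (surface_measure H) (sphere 0 1 \<inter> H) < \<infinity>"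
proof -
  define B where "B = (SOME B. orthonormal_basis_of H B)"
  have B: "orthonormal_basis_of H B"
    unfolding B_def using orthonormal_basis_of_exists[OF assms(1)] by (rule someI_ex)
  have fin: "finite B"
    using B by (rule orthonormal_basis_of_finite)
  have nB: "norm b = 1" if "b \<in> B" for b
    using B that by (auto simp: orthonormal_basis_of_def)
  have H: "H = span B"
    using B by (auto simp: orthonormal_basis_of_def)
  have "B \<noteq> {}"
    using H assms(2) by auto
  define S where "S = (\<lambda>f. \<Sum>b\<in>B. f b *\<^sub>R b)"
  define P where "P = (\<Pi>\<^sub>M b\<in>B. (lborel :: real measure))"
  interpret product_sigma_finite "\<lambda>_. lborel :: real measure" ..
  have S_meas: "S \<in> borel_measurable P"
    unfolding S_def P_def by measurable
  have lb: "lborel_subspace H = distr P borel S"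
    unfolding lborel_subspace_def B_def[symmetric] Let_def P_def S_def ..
  have SH: "S f \<in> H" for f
    unfolding S_def H by (intro span_sum span_scale span_base)
  \<comment> \<open>The punctured unit ball of \<open>H\<close> in the coordinates given by
    \<open>B\<close>.\<close>
  let ?E = "S -` (ball 0 1 - {0}) \<inter> space P"
  have closed_H: "closed H"
    using assms(1) by (rule closed_subspace)
  have sgn_meas: "sgn \<in> measurable (restrict_space M (ball 0 1 - {0})) borel"
    if "sets M = sets borel" for M :: "'a measure"
  proof -
    have "(\<lambda>x::'a. inverse (norm x) *\<^sub>R x) \<in> borel_measurable borel"
      by measurable
    also have "(\<lambda>x::'a. inverse (norm x) *\<^sub>R x) = sgn"
      by (simp add: fun_eq_iff sgn_div_norm)
    also have "borel_measurable borel = (borel_measurable M :: ('a \<Rightarrow> 'a) set)"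
      by (rule measurable_cong_sets) (simp_all add: that)
    finally have "(sgn :: 'a \<Rightarrow> 'a) \<in> borel_measurable M" .
    then show ?thesis
      by (rule measurable_restrict_space1)
  qed
  have dim: "0 < dim H"
    using assms by (metis dim_eq_0 gr0I subset_singletonD subspace_0 empty_iff)
  let ?R = "restrict_space (lborel_subspace H) (ball 0 1 - {0})"
  have sets_lb: "sets (lborel_subspace H) = sets borel"
    by (simp add: lb)
  have sph: "sphere 0 1 \<inter> H \<in> sets borel"
    using closed_H by auto
  have "emeasure (surface_measure H) (sphere 0 1 \<inter> H)
      = of_nat (dim H) * emeasure ?R (sgn -` (sphere 0 1 \<inter> H) \<inter> space ?R)"
    unfolding surface_measure_def
    by (subst emeasure_distr) (use sph sgn_meas[OF sets_lb] in \<open>simp_all add: measurable_def space_scale_measure\<close>)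
  also have "emeasure ?R (sgn -` (sphere 0 1 \<inter> H) \<inter> space ?R)
      = emeasure (lborel_subspace H) (sgn -` (sphere 0 1 \<inter> H) \<inter> space ?R)"
    by (intro emeasure_restrict_space) (auto simp: sets_lb space_restrict_space)
  also have "\<dots> = emeasure P (S -` (sgn -` (sphere 0 1 \<inter> H) \<inter> space ?R) \<inter> space P)"
  proof -
    have "sgn -` (sphere 0 1 \<inter> H) \<inter> space ?R \<in> sets ?R"
      using sgn_meas[OF sets_lb] sph by (rule measurable_sets)
    then have "sgn -` (sphere 0 1 \<inter> H) \<inter> space ?R \<in> sets borel"
      by (auto simp: sets_restrict_space sets_lb)
    then show ?thesis
      using S_meas by (simp add: lb emeasure_distr)
  qed
  \<comment> \<open>Every nonzero vector of \<open>H\<close> is normalised to a unit vector of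
    \<open>H\<close>, so the condition on \<open>sgn\<close> holds throughout the punctured
    ball.\<close>
  also have "S -` (sgn -` (sphere 0 1 \<inter> H) \<inter> space ?R) \<inter> space P = ?E"
  proof -
    have "sgn (S f) \<in> H" for f
      using SH assms(1) by (simp add: sgn_div_norm subspace_scale)
    then show ?thesis
      by (auto simp: space_restrict_space lb norm_sgn)
  qed
  finally have eq: "emeasure (surface_measure H) (sphere 0 1 \<inter> H) = of_nat (dim H) * emeasure P ?E" .
  have E_sets: "?E \<in> sets P"
    using S_meas by (rule measurable_sets) auto
  \<comment> \<open>Coordinates are inner products with unit vectors, hence bounded by the
    norm.\<close>
  have "?E \<subseteq> (\<Pi>\<^sub>E b\<in>B. {-1..1})"
  proof
    fix f assume f: "f \<in> ?E"
    have "\<bar>f b\<bar> \<le> 1" if "b \<in> B" for b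
    proof -
      have "\<bar>S f \<bullet> b\<bar> \<le> norm (S f) * norm b"
        by (rule Cauchy_Schwarz_ineq2)
      then show ?thesis
        using f that nB orthonormal_basis_of_inner_sum[OF B that, of f] by (simp add: S_def)
    qed
    then show "f \<in> (\<Pi>\<^sub>E b\<in>B. {-1..1})"
      using f by (auto simp: P_def space_PiM PiE_def Pi_def abs_le_iff)
  qed
  then have "emeasure P ?E \<le> emeasure P (\<Pi>\<^sub>E b\<in>B. {-1..1})"
    by (rule emeasure_mono) (auto simp: P_def fin intro!: sets_PiM_I_finite)
  also have "\<dots> = (\<Prod>b\<in>B. 2)"
    unfolding P_def by (subst emeasure_PiM) (auto simp: fin)
  also have "\<dots> < \<infinity>"
    by (simp add: ennreal_prod_eq_top less_top power_less_top_ennreal)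
  finally have "emeasure P ?E < \<infinity>" .
  then show "emeasure (surface_measure H) (sphere 0 1 \<inter> H) < \<infinity>"
    unfolding eq by (simp add: ennreal_mult_less_top of_nat_less_top)
  \<comment> \<open>Chosen so that \<open>card B * d < 1\<close>: by the triangle inequality,
    coordinates of size at most \<open>d\<close> give a point of the unit ball. The lower bound
    \<open>d / 2\<close> excludes the origin, as \<open>B\<close> is nonempty.\<close>
  define d where "d = 1 / (real (card B) + 1)"
  have "0 < d"
    by (simp add: d_def)
  have "(\<Pi>\<^sub>E b\<in>B. {d/2..d}) \<subseteq> ?E"
  proof
    fix f assume f: "f \<in> (\<Pi>\<^sub>E b\<in>B. {d/2..d})"
    have fb: "d / 2 \<le> f b" "f b \<le> d" if "b \<in> B" for b
      using f that by (auto simp: PiE_iff)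
    have "norm (S f) \<le> (\<Sum>b\<in>B. norm (f b *\<^sub>R b))"
      unfolding S_def by (rule norm_sum)
    also have "\<dots> \<le> (\<Sum>b\<in>B. d)"
    proof (rule sum_mono)
      fix b assume "b \<in> B"
      then show "norm (f b *\<^sub>R b) \<le> d"
        using fb[of b] nB[of b] \<open>0 < d\<close> by simp
    qed
    also have "\<dots> < 1"
      by (simp add: d_def field_simps)
    finally have "norm (S f) < 1" .
    moreover have "S f \<noteq> 0"
    proof
      assume "S f = 0"
      obtain b where "b \<in> B"
        using \<open>B \<noteq> {}\<close> by auto
      then have "f b = 0"
        using orthonormal_basis_of_inner_sum[OF B, of b f] \<open>S f = 0\<close> by (simp add: S_def)
      then show False
        using fb(1)[OF \<open>b \<in> B\<close>] \<open>0 < d\<close> by simp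
    qed
    ultimately show "f \<in> ?E"
      using f by (auto simp: P_def space_PiM PiE_def)
  qed
  then have "emeasure P (\<Pi>\<^sub>E b\<in>B. {d/2..d}) \<le> emeasure P ?E"
    using E_sets by (rule emeasure_mono)
  moreover have "emeasure P (\<Pi>\<^sub>E b\<in>B. {d/2..d}) = (\<Prod>b\<in>B. ennreal (d / 2))"
    unfolding P_def using \<open>0 < d\<close> by (subst emeasure_PiM) (auto simp: fin)
  moreover have "0 < (\<Prod>b\<in>B. ennreal (d / 2))"
    using \<open>0 < d\<close> by (simp add: ennreal_power)
  ultimately have "0 < emeasure P ?E"
    by simp
  then show "0 < emeasure (surface_measure H) (sphere 0 1 \<inter> H)"
    unfolding eq using dim by (simp add: ennreal_zero_less_mult_iff)
qed

section \<open>Area of a section by a complex line\<close>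

text \<open>The radial integral for complex dimension 1, with antiderivative
  \<open>1 / (2 * (1 - r\<^sup>2))\<close>; the subtracted \<open>1 / 2\<close> is its value at
  0.\<close>

lemma nn_integral_poincare_radial:
  fixes \<rho> :: real
  assumes "0 \<le> \<rho>" and "\<rho> < 1"
  shows "(\<integral>\<^sup>+ r\<in>{0..\<rho>}. ennreal (r / (1 - r\<^sup>2)\<^sup>2) \<partial>lborel) = ennreal (1 / (2 * (1 - \<rho>\<^sup>2)) - 1 / 2)"
proof -
  have "(\<integral>\<^sup>+ r. ennreal (r / (1 - r\<^sup>2)\<^sup>2) * indicator {0..\<rho>} r \<partial>lborel)
      = ennreal (1 / (2 * (1 - \<rho>\<^sup>2)) - 1 / (2 * (1 - 0\<^sup>2)))"
  proof (rule nn_integral_FTC_Icc)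
    fix r assume r: "r \<in> {0..\<rho>}"
    then have "r\<^sup>2 < 1"
      using assms by (simp add: power_less_one_iff)
    define D where "D = 1 - r\<^sup>2"
    have "D \<noteq> 0"
      using \<open>r\<^sup>2 < 1\<close> by (simp add: D_def)
    \<comment> \<open>The derivative is first stated in the raw form produced by the quotient
      rule.\<close>
    then have "((\<lambda>r. 1 / (2 * (1 - r\<^sup>2))) has_real_derivative
        (0 * (2 * D) - 1 * (2 * (0 - 2 * r))) / ((2 * D) * (2 * D))) (at r)"
      unfolding D_def by (auto intro!: derivative_eq_intros)
    also have "(0 * (2 * D) - 1 * (2 * (0 - 2 * r))) / ((2 * D) * (2 * D)) = r / D\<^sup>2"
      using \<open>D \<noteq> 0\<close> by (simp add: field_simps power2_eq_square)
    finally show "((\<lambda>r. 1 / (2 * (1 - r\<^sup>2))) has_real_derivative r / (1 - r\<^sup>2)\<^sup>2) (at r)"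
      by (simp add: D_def)
  qed (use assms in auto)
  then show ?thesis
    by simp
qed

text \<open>By rotation invariance the upper limit of the radial integral is the same for all unit
  vectors of \<open>H\<close>, so the integral over the circle is a constant times its mass.\<close>

lemma HVol_complex_line:
  fixes K :: "(complex ^ 'n) set"
  assumes "body K" and "R_theta_invariant K" and "K \<subseteq> ball 0 1" and x: "norm x = 1"
  defines "H \<equiv> vec.span {x}"
  shows "HVol H K = 8 * (ennreal (1 / (2 * (1 - (inverse (minkowski_functional K x))\<^sup>2)) - 1 / 2)
           * emeasure (surface_measure H) (sphere 0 1 \<inter> H))"
proof -
  define \<rho> where "\<rho> = inverse (minkowski_functional K x)"
  have \<rho>: "0 \<le> \<rho>" "\<rho> < 1"
    using minkowski_functional_gt_1[OF assms(1,3) x] by (auto simp: \<rho>_def field_simps)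
  have "x \<noteq> 0"
    using x by auto
  then have m: "vec.dim H = 1"
    by (simp add: H_def vec.dim_span vec.dim_eq_card_independent vec.dependent_single)
  have "closed H"
    by (simp add: H_def closed_subspace vec_subspace_imp_subspace)
  then have sph: "sphere 0 1 \<inter> H \<in> sets (surface_measure H)"
    by (auto simp: surface_measure_def)
  have "(\<integral>\<^sup>+ y \<in> sphere 0 1 \<inter> H. (\<integral>\<^sup>+ r \<in> {0..inverse (minkowski_functional K y)}.
           ennreal (r / (1 - r\<^sup>2)\<^sup>2) \<partial>lborel) \<partial>surface_measure H)
      = (\<integral>\<^sup>+ y \<in> sphere 0 1 \<inter> H. ennreal (1 / (2 * (1 - \<rho>\<^sup>2)) - 1 / 2) \<partial>surface_measure H)"
  proof (rule nn_integral_cong)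
    fix y
    have "inverse (minkowski_functional K y) = \<rho>" if "y \<in> sphere 0 1 \<inter> H"
      using minkowski_functional_constant_on_span[OF assms(2) x, of y] that
      by (simp add: \<rho>_def H_def)
    then show "(\<integral>\<^sup>+ r \<in> {0..inverse (minkowski_functional K y)}. ennreal (r / (1 - r\<^sup>2)\<^sup>2) \<partial>lborel)
          * indicator (sphere 0 1 \<inter> H) y
        = ennreal (1 / (2 * (1 - \<rho>\<^sup>2)) - 1 / 2) * indicator (sphere 0 1 \<inter> H) y"
      using nn_integral_poincare_radial[OF \<rho>] by (cases "y \<in> sphere 0 1 \<inter> H") auto
  qed
  also have "\<dots> = ennreal (1 / (2 * (1 - \<rho>\<^sup>2)) - 1 / 2) * emeasure (surface_measure H) (sphere 0 1 \<inter> H)"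
    using sph by (rule nn_integral_cmult_indicator)
  \<comment> \<open>With \<open>m = 1\<close> the exponents \<open>2 * m - 1\<close> and
    \<open>m + 1\<close> become 1 and 2, and \<open>8 ^ m\<close> becomes 8.\<close>
  finally show ?thesis
    unfolding HVol_def Let_def m \<rho>_def by (simp add: numeral_2_eq_2)
qed

text \<open>Both areas are \<open>8 * c\<close> times a value of \<open>F\<close>, which is strictly
  increasing on \<open>[0, 1)\<close>, so the inequality of areas passes to the radii.\<close>

lemma minkowski_functional_le_of_HVol_le:
  fixes K L :: "(complex ^ 'n) set"
  assumes K: "body K" "R_theta_invariant K" "K \<subseteq> ball 0 1"
    and L: "body L" "R_theta_invariant L" "L \<subseteq> ball 0 1"
    and x: "norm x = 1"
    and le: "HVol (vec.span {x}) K \<le> HVol (vec.span {x}) L"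
  shows "inverse (minkowski_functional K x) \<le> inverse (minkowski_functional L x)"
proof -
  define H where "H = vec.span {x}"
  define c where "c = emeasure (surface_measure H) (sphere 0 1 \<inter> H)"
  define k where "k = inverse (minkowski_functional K x)"
  define l where "l = inverse (minkowski_functional L x)"
  define F :: "real \<Rightarrow> real" where "F \<rho> = 1 / (2 * (1 - \<rho>\<^sup>2)) - 1 / 2" for \<rho>
  have kl: "0 \<le> k" "k < 1" "0 \<le> l" "l < 1"
    using minkowski_functional_gt_1[OF K(1,3) x] minkowski_functional_gt_1[OF L(1,3) x]
    by (simp_all add: k_def l_def inverse_less_1_iff)
  then have sq: "k\<^sup>2 < 1" "l\<^sup>2 < 1"
    by (simp_all add: power_less_one_iff)
  have "x \<in> H" "x \<noteq> 0"
    using x by (auto simp: H_def vec.span_base)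
  then have c: "0 < c" "c < \<infinity>"
    using emeasure_surface_measure_sphere[of H] unfolding c_def
    by (auto simp: H_def vec_subspace_imp_subspace)
  have "8 * (ennreal (F k) * c) \<le> 8 * (ennreal (F l) * c)"
    using le HVol_complex_line[OF K x] HVol_complex_line[OF L x]
    by (simp add: F_def k_def l_def c_def H_def)
  then have "ennreal (F k) \<le> ennreal (F l)"
    using c by (simp add: ennreal_mult_le_mult_iff mult.commute[of _ c])
  \<comment> \<open>Since \<open>ennreal\<close> sends negative reals to 0, this is what lets the
    inequality return to the reals.\<close>
  moreover have "0 \<le> F l"
    using sq by (simp add: F_def field_simps)
  ultimately have "F k \<le> F l"
    by simp
  then have "k\<^sup>2 \<le> l\<^sup>2"
    using sq by (simp add: F_def field_simps)
  then show ?thesis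
    unfolding k_def[symmetric] l_def[symmetric] using kl(3) by (rule power2_le_imp_le)
qed

theorem mainTheorem2:
  fixes K L :: "(complex ^ 'n) set"
  assumes "CARD('n) \<ge> 3"
    and "body K" and "R_theta_invariant K" and "h_convex K"
    and "body L" and "R_theta_invariant L" and "h_convex L"
    and "\<And>H. vec.subspace H \<Longrightarrow> vec.dim H = 1 \<Longrightarrow> HVol H K \<le> HVol H L"
  shows "HVol UNIV K \<le> HVol UNIV L"
proof -
  have ball: "K \<subseteq> ball 0 1" "L \<subseteq> ball 0 1"
    using assms(4,7) by (auto simp: h_convex_def)
  have rad: "inverse (minkowski_functional K x) \<le> inverse (minkowski_functional L x)"
    if x: "norm x = 1" for x
  proof -
    have "x \<noteq> 0"
      using x by auto
    then have "vec.dim (vec.span {x}) = 1"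
      by (simp add: vec.dim_span vec.dim_eq_card_independent vec.dependent_single)
    then have "HVol (vec.span {x}) K \<le> HVol (vec.span {x}) L"
      by (intro assms(8)) simp
    with x show ?thesis
      using minkowski_functional_le_of_HVol_le assms(2,3,5,6) ball by blast
  qed
  \<comment> \<open>The bodies enter \<open>HVol\<close> only through the upper limit of the inner
    integral. By \<open>rad\<close> the range for \<open>K\<close> is contained in the range for
    \<open>L\<close>, and the integrands take values in \<open>ennreal\<close>.\<close>
  show ?thesis
    unfolding HVol_def Let_def
    by (intro mult_left_mono nn_integral_mono)
      (auto split: split_indicator intro!: nn_integral_mono dest: order_trans[OF _ rad])
qed

end
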